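(* The numerical scheme $$\frac{\phi^{n+1}-\phi^{n}}{\Delta t}=\mathcal{M}\Delta_h\mu_\phi^{n+1},\qquad \frac{\rho^{n+1}-\rho^{n}}{\Delta t}=\mathcal{M}\Delta_h\mu_\rho^{n+1},$$ $$\mu_{\phi}^{n+1}=\frac{1}{\varepsilon}\Big(\phi^{n+1}-\frac12\Big)^{3}-\Big(\varepsilon+\alpha+\frac{\alpha}{\delta}\Big)\Delta_h\phi^{n+1}+\eta^{2}\Delta_h^{2}\phi^{n+1}+\alpha\nabla_h\cdot\Big(\mathcal{A}\Big(\frac{\rho^{n+1}}{\mathcal{A}|\nabla_h^\delta\phi^{n+1}|}\Big)\nabla_h\phi^{n+1}\Big)-\frac{1}{4\varepsilon}\Big(\phi^{n}-\frac12\Big)+\frac{\alpha}{\delta}\Delta_h\phi^{n},$$ $$\mu_{\rho}^{n+1}=-\xi\Delta_h\rho^{n+1}+\beta\big(\ln\rho^{n+1}-\ln(1-\rho^{n+1})\big)+\sqrt2\,\alpha\rho^{n+1}-\alpha\,\mathcal{A}|\nabla_h^\delta\phi^{n+1}|-\alpha(\sqrt2-1)\rho^{n},$$ is unconditionally energy stable: for every $\Delta t>0$ and $h>0$, and for $n\ge 1$, if $\phi^n,\rho^n,\phi^{n+1},\rho^{n+1}\in\mathcal{C}_{per}$ satisfy the scheme, with $0<\rho^n<1$ and $0<\rho^{n+1}<1$ point-wise, then $$E(\phi^{n+1},\rho^{n+1})\le E(\phi^{n},\rho^{n}),$$ where $E$ is the discrete energy $$E(\phi,\rho)=h^{2}\sum_{i,j=1}^{N}\Big(\frac{f(\phi_{i,j})}{\varepsilon}+\frac{\varepsilon}{2}|\nabla_{h}\phi_{i,j}|^{2}+\frac{\eta^{2}}{2}|\Delta_{h}\phi_{i,j}|^{2}+\frac{\xi}{2}|\nabla_{h}\rho_{i,j}|^{2}+\frac{\alpha}{2}\big(\rho_{i,j}-\mathcal{A}|\nabla_{h}^\delta\phi|_{i,j}\big)^{2}+\beta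 H(\rho_{i,j})\Big).$$
   Context: Parameters: $\alpha,\beta,\varepsilon,\eta,\xi,\delta,\mathcal{M}>0$ are fixed constants. $f(\phi)=\frac14\phi^2(1-\phi)^2$ and $H(\rho)=\rho\ln\rho+(1-\rho)\ln(1-\rho)$. Grid: $\Omega=(0,L)^2$, $N\in\mathbb{N}$, $h=L/N$. $\mathcal{C}_{per}$ is the space of real (cell-centered) grid functions $\nu=(\nu_{i,j})_{i,j\in\mathbb{Z}}$ that are $N$-periodic in each index. Differences: $(D_x\nu)_{i+\frac12,j}=\frac{1}{h}(\nu_{i+1,j}-\nu_{i,j})$, $(D_y\nu)_{i,j+\frac12}=\frac1h(\nu_{i,j+1}-\nu_{i,j})$; $\nabla_h\nu=(D_x\nu,D_y\nu)$ (edge-centered). For an edge-centered vector field $\vec f=(f^x,f^y)$, $(\nabla_h\cdot\vec f)_{i,j}=\frac1h(f^x_{i+\frac12,j}-f^x_{i-\frac12,j})+\frac1h(f^y_{i,j+\frac12}-f^y_{i,j-\frac12})$. $\Delta_h\nu=\nabla_h\cdot(\nabla_h\nu)$ is the standard periodic five-point Laplacian. In the energy, $h^2\sum_{i,j=1}^N|\nabla_h\nu_{i,j}|^2=h^2\sum_{i,j=1}^N\big((D_x\nu)_{i+\frac12,j}^2+(D_y\nu)_{i,j+\frac12}^2\big)$. The cell-centered quantity $\mathcal{A}|\nabla_h^\delta\phi|$ is defined by $$\big(\mathcal{A}|\nabla_h^\delta\phi|_{i,j}\big)^2=\tfrac12\big((D_x\phi)_{i+\frac12,j}^2+(D_x\phi)_{i-\frac12,j}^2+(D_y\phi)_{i,j+\frac12}^2+(D_y\phi)_{i,j-\frac12}^2\big)+\delta^2,\qquad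 \mathcal{A}|\nabla_h^\delta\phi|_{i,j}>0.$$ For a cell-centered $g$, the outer $\mathcal{A}(g)$ in $\nabla_h\cdot(\mathcal{A}(g)\nabla_h\phi)$ is the arithmetic average onto edges: $\mathcal{A}(g)_{i+\frac12,j}=\frac12(g_{i,j}+g_{i+1,j})$, $\mathcal{A}(g)_{i,j+\frac12}=\frac12(g_{i,j}+g_{i,j+1})$. All nonlinear operations on grid functions are point-wise. *)

theory Defs
  imports "HOL-Analysis.Analysis"
begin

type_synonym grid_fun = "int \<Rightarrow> int \<Rightarrow> real"

text \<open>An edge-centered vector field is a pair of arrays, with half-integer indices shifted down:
  position \<open>(i, j)\<close> of the first array is the value at the edge \<open>(i + 1/2, j)\<close>, and position
  \<open>(i, j)\<close> of the second array is the value at the edge \<open>(i, j + 1/2)\<close>.\<close>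

type_synonym edge_field = "grid_fun \<times> grid_fun"

definition C_per :: "nat \<Rightarrow> grid_fun set" where
  "C_per N = {\<nu>. \<forall>i j. \<nu> (i + int N) j = \<nu> i j \<and> \<nu> i (j + int N) = \<nu> i j}"

definition D_x :: "real \<Rightarrow> grid_fun \<Rightarrow> grid_fun" where
  "D_x h \<nu> = (\<lambda>i j. (\<nu> (i + 1) j - \<nu> i j) / h)"

definition D_y :: "real \<Rightarrow> grid_fun \<Rightarrow> grid_fun" where
  "D_y h \<nu> = (\<lambda>i j. (\<nu> i (j + 1) - \<nu> i j) / h)"

definition grad_h :: "real \<Rightarrow> grid_fun \<Rightarrow> edge_field" where
  "grad_h h \<nu> = (D_x h \<nu>, D_y h \<nu>)"

definition div_h :: "real \<Rightarrow> edge_field \<Rightarrow> grid_fun" where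
  "div_h h F = (\<lambda>i j. (fst F i j - fst F (i - 1) j) / h + (snd F i j - snd F i (j - 1)) / h)"

definition laplace_h :: "real \<Rightarrow> grid_fun \<Rightarrow> grid_fun" where
  "laplace_h h \<nu> = div_h h (grad_h h \<nu>)"

definition grad_sq :: "real \<Rightarrow> grid_fun \<Rightarrow> grid_fun" where
  "grad_sq h \<nu> = (\<lambda>i j. (D_x h \<nu> i j)\<^sup>2 + (D_y h \<nu> i j)\<^sup>2)"

definition edge_avg :: "grid_fun \<Rightarrow> edge_field" where
  "edge_avg g = (\<lambda>i j. (g i j + g (i + 1) j) / 2, \<lambda>i j. (g i j + g i (j + 1)) / 2)"

definition edge_mult :: "edge_field \<Rightarrow> edge_field \<Rightarrow> edge_field" where
  "edge_mult F G = (\<lambda>i j. fst F i j * fst G i j, \<lambda>i j. snd F i j * snd G i j)"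

text \<open>The cell-centered regularized gradient modulus \<open>\<A>|\<nabla>\<^sub>h\<^sup>\<delta> \<phi>|\<close>.\<close>

definition avg_grad :: "real \<Rightarrow> real \<Rightarrow> grid_fun \<Rightarrow> grid_fun" where
  "avg_grad h \<delta> \<phi> = (\<lambda>i j. sqrt (1 / 2 *
     ((D_x h \<phi> i j)\<^sup>2 + (D_x h \<phi> (i - 1) j)\<^sup>2 + (D_y h \<phi> i j)\<^sup>2 + (D_y h \<phi> i (j - 1))\<^sup>2) + \<delta>\<^sup>2))"

lemma avg_grad_square:
  "(avg_grad h \<delta> \<phi> i j)\<^sup>2 = 1 / 2 *
     ((D_x h \<phi> i j)\<^sup>2 + (D_x h \<phi> (i - 1) j)\<^sup>2 + (D_y h \<phi> i j)\<^sup>2 + (D_y h \<phi> i (j - 1))\<^sup>2) + \<delta>\<^sup>2"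
  unfolding avg_grad_def by (simp add: add_nonneg_nonneg)

lemma avg_grad_pos:
  assumes "\<delta> > 0"
  shows "avg_grad h \<delta> \<phi> i j > 0"
  using assms unfolding avg_grad_def by (simp add: add_nonneg_pos)

definition f_dw :: "real \<Rightarrow> real" where
  "f_dw x = 1 / 4 * x\<^sup>2 * (1 - x)\<^sup>2"

definition H_mix :: "real \<Rightarrow> real" where
  "H_mix x = x * ln x + (1 - x) * ln (1 - x)"

text \<open>In the chemical potentials below, \<open>\<phi>\<close>, \<open>\<rho>\<close> are the values at time level \<open>n\<close>, and \<open>\<phi>'\<close>, \<open>\<rho>'\<close>
  those at level \<open>n + 1\<close>.\<close>

definition mu_phi ::
  "real \<Rightarrow> real \<Rightarrow> real \<Rightarrow> real \<Rightarrow> real \<Rightarrow> grid_fun \<Rightarrow> grid_fun \<Rightarrow> grid_fun \<Rightarrow> grid_fun" where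
  "mu_phi \<alpha> \<epsilon> \<eta> \<delta> h \<phi> \<phi>' \<rho>' = (\<lambda>i j.
      1 / \<epsilon> * (\<phi>' i j - 1 / 2) ^ 3
    - (\<epsilon> + \<alpha> + \<alpha> / \<delta>) * laplace_h h \<phi>' i j
    + \<eta>\<^sup>2 * laplace_h h (laplace_h h \<phi>') i j
    + \<alpha> * div_h h (edge_mult (edge_avg (\<lambda>k l. \<rho>' k l / avg_grad h \<delta> \<phi>' k l)) (grad_h h \<phi>')) i j
    - 1 / (4 * \<epsilon>) * (\<phi> i j - 1 / 2)
    + \<alpha> / \<delta> * laplace_h h \<phi> i j)"

definition mu_rho ::
  "real \<Rightarrow> real \<Rightarrow> real \<Rightarrow> real \<Rightarrow> real \<Rightarrow> grid_fun \<Rightarrow> grid_fun \<Rightarrow> grid_fun \<Rightarrow> grid_fun" where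
  "mu_rho \<alpha> \<beta> \<xi> \<delta> h \<rho> \<phi>' \<rho>' = (\<lambda>i j.
    - \<xi> * laplace_h h \<rho>' i j
    + \<beta> * (ln (\<rho>' i j) - ln (1 - \<rho>' i j))
    + sqrt 2 * \<alpha> * \<rho>' i j
    - \<alpha> * avg_grad h \<delta> \<phi>' i j
    - \<alpha> * (sqrt 2 - 1) * \<rho> i j)"

definition scheme_step ::
  "real \<Rightarrow> real \<Rightarrow> real \<Rightarrow> real \<Rightarrow> real \<Rightarrow> real \<Rightarrow> real \<Rightarrow> real \<Rightarrow> real \<Rightarrow>
   grid_fun \<Rightarrow> grid_fun \<Rightarrow> grid_fun \<Rightarrow> grid_fun \<Rightarrow> bool" where
  "scheme_step \<alpha> \<beta> \<epsilon> \<eta> \<xi> \<delta> M h dt \<phi> \<rho> \<phi>' \<rho>' \<longleftrightarrow> (\<forall>i j.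
     (\<phi>' i j - \<phi> i j) / dt = M * laplace_h h (mu_phi \<alpha> \<epsilon> \<eta> \<delta> h \<phi> \<phi>' \<rho>') i j \<and>
     (\<rho>' i j - \<rho> i j) / dt = M * laplace_h h (mu_rho \<alpha> \<beta> \<xi> \<delta> h \<rho> \<phi>' \<rho>') i j)"

definition energy ::
  "real \<Rightarrow> real \<Rightarrow> real \<Rightarrow> real \<Rightarrow> real \<Rightarrow> real \<Rightarrow> nat \<Rightarrow> real \<Rightarrow> grid_fun \<Rightarrow> grid_fun \<Rightarrow> real" where
  "energy \<alpha> \<beta> \<epsilon> \<eta> \<xi> \<delta> N h \<phi> \<rho> = h\<^sup>2 * (\<Sum>i = 1..int N. \<Sum>j = 1..int N.
      f_dw (\<phi> i j) / \<epsilon>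
    + \<epsilon> / 2 * grad_sq h \<phi> i j
    + \<eta>\<^sup>2 / 2 * \<bar>laplace_h h \<phi> i j\<bar>\<^sup>2
    + \<xi> / 2 * grad_sq h \<rho> i j
    + \<alpha> / 2 * (\<rho> i j - avg_grad h \<delta> \<phi> i j)\<^sup>2
    + \<beta> * H_mix (\<rho> i j))"

end

theory Submission
  imports Defs
begin

text \<open>The scheme is a convex splitting: all implicit terms come from a functional that is convex in
  \<open>(\<phi>, \<rho>)\<close>, all explicit ones from a concave functional. Convexity of the coupled part
  \<open>(1 + 1 / \<delta>) |p|\<^sup>2 / 2 - \<rho> \<surd>(|p|\<^sup>2 + \<delta>\<^sup>2) + \<surd>2 \<rho>\<^sup>2 / 2\<close> for \<open>0 < \<rho> < 1\<close> holds cell by cell, because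
  \<open>\<surd>(|p|\<^sup>2 + \<delta>\<^sup>2)\<close> is 1-Lipschitz and has second derivative at most \<open>1 / \<delta>\<close>. The tangent inequalities,
  summed over a period and integrated by parts, bound the energy increment by
  \<open>\<langle>\<mu>\<^sub>\<phi>, \<phi>' - \<phi>\<rangle> + \<langle>\<mu>\<^sub>\<rho>, \<rho>' - \<rho>\<rangle>\<close>, which the scheme turns into
  \<open>- M dt (\<parallel>\<nabla>\<^sub>h \<mu>\<^sub>\<phi>\<parallel>\<^sup>2 + \<parallel>\<nabla>\<^sub>h \<mu>\<^sub>\<rho>\<parallel>\<^sup>2)\<close>.\<close>

subsection \<open>Tangent inequalities in a single cell\<close>

lemma half_square_tangent: "(x\<^sup>2 - y\<^sup>2) / 2 \<le> x * (x - y)" for x y :: real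
  using zero_le_power2[of "x - y"] by (simp add: power2_eq_square field_simps)

text \<open>In the centred variable \<open>a = x - 1 / 2\<close> the double well is a^4/4 - a^2/8 +
  1/64. The convex quartic is linearized at the new value \<open>x\<close>, the concave quadratic at
  the old value \<open>y\<close>.\<close>

lemma f_dw_tangent: "f_dw x - f_dw y \<le> ((x - 1 / 2) ^ 3 - (y - 1 / 2) / 4) * (x - y)"
proof -
  define a b where "a = x - 1 / 2" and "b = y - 1 / 2"
  have xy: "x = a + 1 / 2" "y = b + 1 / 2" by (simp_all add: a_def b_def)
  \<comment> \<open>The first summand is the gap of the quartic's tangent at \<open>a\<close>, the
    second that of the concave quadratic at \<open>b\<close>.\<close>
  have "(a ^ 3 - b / 4) * (a - b) - (f_dw x - f_dw y)
      = ((a - b)\<^sup>2 * (2 * a\<^sup>2 + (a + b)\<^sup>2)) / 4 + (a - b)\<^sup>2 / 8"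
    unfolding f_dw_def xy by (simp add: power2_eq_square power3_eq_cube field_simps)
  also have "\<dots> \<ge> 0" by simp
  finally show ?thesis by (simp add: a_def b_def)
qed

lemma mult_ln_tangent:
  fixes x y :: real
  assumes "x > 0" "y > 0"
  shows "x * ln x - y * ln y \<le> (ln x + 1) * (x - y)"
proof -
  have "ln (x / y) \<le> x / y - 1" using assms by (intro ln_le_minus_one) simp
  then have "y * (ln x - ln y) \<le> y * (x / y - 1)"
    using assms by (simp add: ln_div)
  then show ?thesis using assms by (simp add: algebra_simps)
qed

text \<open>The increments of \<open>x\<close> and \<open>1 - x\<close> are opposite, so the
  constants 1 in the two derivatives \<open>ln x + 1\<close> and \<open>ln (1 - x) + 1\<close>
  cancel.\<close>

lemma H_mix_tangent:
  assumes "0 < x" "x < 1" "0 < y" "y < 1"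
  shows "H_mix x - H_mix y \<le> (ln x - ln (1 - x)) * (x - y)"
  using mult_ln_tangent[of x y] mult_ln_tangent[of "1 - x" "1 - y"] assms
  unfolding H_mix_def by (simp add: algebra_simps)

text \<open>Here \<open>p\<close>, \<open>r\<close> are new and \<open>q\<close>, \<open>s\<close>
  old values. Adding and subtracting |p|^2 / (2 \<delta>) and (sqrt 2 - 1) r^2 / 2 makes the
  coupling a difference of convex parts; the terms paired with \<open>q\<close> and \<open>s\<close>
  come from the subtracted ones.\<close>

lemma coupling_tangent:
  fixes p q :: "'a::real_inner" and r s a b \<delta> :: real
  assumes \<delta>: "\<delta> > 0" and r: "0 \<le> r" "r \<le> 1"
    and a: "a = sqrt (p \<bullet> p + \<delta>\<^sup>2)" and b: "b = sqrt (q \<bullet> q + \<delta>\<^sup>2)"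
  shows "((r - a)\<^sup>2 - (s - b)\<^sup>2) / 2 \<le>
    (1 + 1 / \<delta>) * (p \<bullet> (p - q)) - 1 / \<delta> * (q \<bullet> (p - q)) - r / a * (p \<bullet> (p - q))
    - a * (r - s) + sqrt 2 * r * (r - s) - (sqrt 2 - 1) * s * (r - s)"
proof -
  define m where "m = (p - q) \<bullet> (p - q)"
  have m0: "m \<ge> 0" by (simp add: m_def)
  have a2: "a\<^sup>2 = p \<bullet> p + \<delta>\<^sup>2" and b2: "b\<^sup>2 = q \<bullet> q + \<delta>\<^sup>2" using a b by simp_all
  \<comment> \<open>Appending \<delta> as a coordinate turns both roots into norms, so the reverse
    triangle inequality gives the Lipschitz bound.\<close>
  have an: "a = norm (p, \<delta>)" and bn: "b = norm (q, \<delta>)"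
    unfolding a b by (simp_all add: norm_Pair power2_norm_eq_inner)
  have "\<bar>a - b\<bar> \<le> norm ((p, \<delta>) - (q, \<delta>))"
    unfolding an bn by (rule norm_triangle_ineq3)
  also have "\<dots> = norm (p - q)" by (simp add: norm_Pair)
  finally have "\<bar>a - b\<bar>\<^sup>2 \<le> (norm (p - q))\<^sup>2" by (rule power_mono) simp
  then have lip: "(a - b)\<^sup>2 \<le> m" by (simp add: m_def power2_norm_eq_inner)
  have a\<delta>: "a \<ge> \<delta>" unfolding a by (rule real_le_rsqrt) simp
  then have apos: "a > 0" using \<delta> by simp
  \<comment> \<open>\<open>R\<close> is the gap between the root at \<open>q\<close> and its tangent
    at \<open>p\<close>, see \<open>tan\<close> below. The Lipschitz bound makes it nonnegative, and
    a \<ge> \<delta> bounds it from above.\<close>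
  define R where "R = (m - (a - b)\<^sup>2) / (2 * a)"
  have "R \<le> m / (2 * a)" using apos by (simp add: R_def divide_right_mono)
  also have "\<dots> \<le> m / (2 * \<delta>)" using a\<delta> \<delta> m0 by (intro divide_left_mono) auto
  finally have R: "R \<le> m / (2 * \<delta>)" .
  have R0: "R \<ge> 0" using lip apos by (simp add: R_def)
  have "r * R \<le> 1 * R" using r R0 by (intro mult_right_mono) auto
  also have "\<dots> \<le> m / \<delta>" using R m0 \<delta> by (smt (verit) frac_le)
  finally have rR: "r * R \<le> m / \<delta>" .
  have m_eq: "m = p \<bullet> (p - q) - q \<bullet> (p - q)"
    by (simp add: m_def inner_diff_left)
  have pq: "p \<bullet> (p - q) = (a\<^sup>2 - b\<^sup>2 + m) / 2"
    unfolding a2 b2 m_def by (simp add: inner_diff_left inner_diff_right inner_commute)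
  have tan: "p \<bullet> (p - q) / a = a - b + R"
    unfolding pq R_def using apos by (simp add: field_simps power2_eq_square)
  have e1: "r / a * (p \<bullet> (p - q)) = r * a - r * b + r * R"
    using arg_cong[OF tan, of "(*) r"] by (simp add: distrib_left right_diff_distrib)
  \<comment> \<open>The implicit and explicit 1 / \<delta> terms differ by exactly
    \<open>m / \<delta>\<close>, which absorbs \<open>r * R\<close>.\<close>
  have "x + m / \<delta> = (1 + 1 / \<delta>) * x - 1 / \<delta> * y" if "m = x - y" for x y
    unfolding that by (simp add: algebra_simps diff_divide_distrib)
  from this[OF m_eq] have e2: "(1 + 1 / \<delta>) * (p \<bullet> (p - q)) - 1 / \<delta> * (q \<bullet> (p - q))
      = (a\<^sup>2 - b\<^sup>2 + m) / 2 + m / \<delta>"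
    unfolding pq by simp
  have e3: "sqrt 2 * r * (r - s) - (sqrt 2 - 1) * s * (r - s)
      = (r\<^sup>2 - s\<^sup>2) / 2 + (sqrt 2 - 1 / 2) * (r - s)\<^sup>2"
    by (simp add: power2_eq_square field_simps)
  \<comment> \<open>Since sqrt 2 \<ge> 1, the surplus in \<open>e3\<close> covers the (r - s)^2 / 2
    that Young's inequality costs for the cross term (r - s)(a - b); the remaining (a - b)^2 / 2 is
    covered by \<open>m / 2\<close> through \<open>lip\<close>.\<close>
  have "1 / 2 * (r - s)\<^sup>2 \<le> (sqrt 2 - 1 / 2) * (r - s)\<^sup>2"
    by (intro mult_right_mono) auto
  moreover have "r * a - r * b - s * a + s * b \<le> 1 / 2 * (r - s)\<^sup>2 + (a - b)\<^sup>2 / 2"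
    using zero_le_power2[of "(r - s) - (a - b)"] by (simp add: power2_eq_square field_simps)
  moreover have "((r - a)\<^sup>2 - (s - b)\<^sup>2) / 2
      = (r\<^sup>2 - s\<^sup>2) / 2 + (a\<^sup>2 - b\<^sup>2) / 2 - r * a + s * b"
    by (simp add: power2_eq_square field_simps)
  moreover have "a * (r - s) = r * a - s * a" by (simp add: algebra_simps)
  ultimately have "((r - a)\<^sup>2 - (s - b)\<^sup>2) / 2 \<le>
    ((a\<^sup>2 - b\<^sup>2 + m) / 2 + m / \<delta>) - (r * a - r * b + r * R) - a * (r - s)
    + ((r\<^sup>2 - s\<^sup>2) / 2 + (sqrt 2 - 1 / 2) * (r - s)\<^sup>2)"
    using rR lip by argo
  then show ?thesis unfolding e1 e2 e3[symmetric] by simp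
qed

subsection \<open>Summation over a period\<close>

definition gsum :: "nat \<Rightarrow> grid_fun \<Rightarrow> real" where
  "gsum N g = (\<Sum>i = 1..int N. \<Sum>j = 1..int N. g i j)"

lemma gsum_add: "gsum N (\<lambda>i j. f i j + g i j) = gsum N f + gsum N g"
  by (simp add: gsum_def sum.distrib)

lemma gsum_diff: "gsum N (\<lambda>i j. f i j - g i j) = gsum N f - gsum N g"
  by (simp add: gsum_def sum_subtractf)

lemma gsum_cmult: "gsum N (\<lambda>i j. c * f i j) = c * gsum N f"
  by (simp add: gsum_def sum_distrib_left)

lemma gsum_mono: "(\<And>i j. f i j \<le> g i j) \<Longrightarrow> gsum N f \<le> gsum N g"
  by (simp add: gsum_def sum_mono)

lemma gsum_nonneg: "(\<And>i j. f i j \<ge> 0) \<Longrightarrow> gsum N f \<ge> 0"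
  by (simp add: gsum_def sum_nonneg)

lemma C_perI:
  "(\<And>i j. g (i + int N) j = g i j) \<Longrightarrow> (\<And>i j. g i (j + int N) = g i j) \<Longrightarrow> g \<in> C_per N"
  by (simp add: C_per_def)

lemma C_perD:
  assumes "g \<in> C_per N"
  shows "g (i + int N) j = g i j" "g i (j + int N) = g i j"
  using assms by (simp_all add: C_per_def)

lemma C_perD_shift:
  assumes "g \<in> C_per N"
  shows "g (i + int N + k) j = g (i + k) j" "g (i + int N - k) j = g (i - k) j"
    "g i (j + int N + k) = g i (j + k)" "g i (j + int N - k) = g i (j - k)"
  using C_perD[OF assms, of "i + k" j] C_perD[OF assms, of "i - k" j]
    C_perD[OF assms, of i "j + k"] C_perD[OF assms, of i "j - k"]
  by (simp_all add: algebra_simps)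

lemmas C_per_shifts = C_perD C_perD_shift

lemma sum_period_shift:
  fixes g :: "int \<Rightarrow> real"
  assumes "\<And>i. g (i + int N) = g i"
  shows "(\<Sum>i = 1..int N. g (i - 1)) = (\<Sum>i = 1..int N. g i)"
proof (cases "N = 0")
  case False
  \<comment> \<open>The shifted sum runs over 0..N-1; it differs from the original only by having
    the value at 0 in place of the equal value at N.\<close>
  then have "{1..int N} = insert (int N) {1..int N - 1}" and "{0..int N - 1} = insert 0 {1..int N - 1}"
    by auto
  moreover have "(\<Sum>i = 1..int N. g (i - 1)) = (\<Sum>i = 0..int N - 1. g i)"
    by (rule sum.reindex_bij_witness[of _ "\<lambda>i. i + 1" "\<lambda>i. i - 1"]) auto
  ultimately show ?thesis using assms[of 0] by simp
qed simp

lemma gsum_shift: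
  assumes "g \<in> C_per N"
  shows "gsum N (\<lambda>i j. g (i - 1) j) = gsum N g" "gsum N (\<lambda>i j. g i (j - 1)) = gsum N g"
proof -
  have "(\<Sum>j = 1..int N. g i (j - 1)) = (\<Sum>j = 1..int N. g i j)" for i
    using C_perD(2)[OF assms] by (rule sum_period_shift)
  then show "gsum N (\<lambda>i j. g i (j - 1)) = gsum N g" by (simp add: gsum_def)
  show "gsum N (\<lambda>i j. g (i - 1) j) = gsum N g"
    unfolding gsum_def
    by (rule sum_period_shift[of "\<lambda>i. \<Sum>j = 1..int N. g i j"]) (simp add: C_perD[OF assms])
qed

section \<open>Edge fields and periodicity of the discrete operators\<close>

definition edge_per :: "nat \<Rightarrow> edge_field set" where
  "edge_per N = C_per N \<times> C_per N"

definition edge_dot :: "edge_field \<Rightarrow> edge_field \<Rightarrow> grid_fun" where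
  "edge_dot F G = (\<lambda>i j. fst F i j * fst G i j + snd F i j * snd G i j)"

text \<open>The mean over the two x-edges plus the mean over the two y-edges, hence 2 and not 4 in
  the denominator. Applied to the squared gradient it gives \<open>avg_grad\<close> squared minus
  \<delta>^2.\<close>

definition cell_avg :: "edge_field \<Rightarrow> grid_fun" where
  "cell_avg F = (\<lambda>i j. (fst F i j + fst F (i - 1) j + snd F i j + snd F i (j - 1)) / 2)"

lemma grad_per: "g \<in> C_per N \<Longrightarrow> grad_h h g \<in> edge_per N"
  by (auto simp: edge_per_def grad_h_def D_x_def D_y_def C_per_shifts intro!: C_perI)

lemma div_per: "F \<in> edge_per N \<Longrightarrow> div_h h F \<in> C_per N"
  by (auto simp: edge_per_def div_h_def C_per_shifts intro!: C_perI)

lemma laplace_per: "g \<in> C_per N \<Longrightarrow> laplace_h h g \<in> C_per N"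
  by (simp add: laplace_h_def grad_per div_per)

lemma edge_avg_per: "g \<in> C_per N \<Longrightarrow> edge_avg g \<in> edge_per N"
  by (auto simp: edge_per_def edge_avg_def C_per_shifts intro!: C_perI)

lemma edge_mult_per: "F \<in> edge_per N \<Longrightarrow> G \<in> edge_per N \<Longrightarrow> edge_mult F G \<in> edge_per N"
  by (auto simp: edge_per_def edge_mult_def C_per_shifts intro!: C_perI)

lemma avg_grad_per: "g \<in> C_per N \<Longrightarrow> avg_grad h \<delta> g \<in> C_per N"
  using grad_per[of g N h]
  by (auto simp: edge_per_def grad_h_def avg_grad_def C_per_shifts intro!: C_perI)

lemma mu_phi_per:
  assumes "\<phi> \<in> C_per N" "\<phi>' \<in> C_per N" "\<rho>' \<in> C_per N"
  shows "mu_phi \<alpha> \<epsilon> \<eta> \<delta> h \<phi> \<phi>' \<rho>' \<in> C_per N"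
proof -
  have "(\<lambda>k l. \<rho>' k l / avg_grad h \<delta> \<phi>' k l) \<in> C_per N"
    using C_perD[OF assms(3)] C_perD[OF avg_grad_per[OF assms(2)]] by (simp add: C_per_def)
  then have "div_h h (edge_mult (edge_avg (\<lambda>k l. \<rho>' k l / avg_grad h \<delta> \<phi>' k l)) (grad_h h \<phi>')) \<in> C_per N"
    by (intro div_per edge_mult_per edge_avg_per grad_per assms)
  with assms show ?thesis
    unfolding mu_phi_def by (intro C_perI) (simp_all add: C_perD laplace_per)
qed

lemma mu_rho_per:
  assumes "\<rho> \<in> C_per N" "\<phi>' \<in> C_per N" "\<rho>' \<in> C_per N"
  shows "mu_rho \<alpha> \<beta> \<xi> \<delta> h \<rho> \<phi>' \<rho>' \<in> C_per N"
  using assms unfolding mu_rho_def by (intro C_perI) (simp_all add: C_perD laplace_per avg_grad_per)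

section \<open>Summation by parts and adjointness of the averages\<close>

lemma sum_by_parts:
  assumes g: "g \<in> C_per N" and F: "F \<in> edge_per N"
  shows "gsum N (\<lambda>i j. div_h h F i j * g i j) = - gsum N (edge_dot F (grad_h h g))"
proof -
  \<comment> \<open>Discrete product rule: pairing each edge flux with \<open>g\<close> in the cell
    ahead of the edge makes the integrand a pure difference, which telescopes over a period.\<close>
  define A B where "A = (\<lambda>i j. g (i + 1) j * fst F i j / h)"
    and "B = (\<lambda>i j. g i (j + 1) * snd F i j / h)"
  have per: "A \<in> C_per N" "B \<in> C_per N"
    using g F by (auto simp: A_def B_def edge_per_def C_per_shifts intro!: C_perI)
  have "div_h h F i j * g i j + edge_dot F (grad_h h g) i j
      = (A i j - A (i - 1) j) + (B i j - B i (j - 1))" for i j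
    by (simp add: div_h_def edge_dot_def grad_h_def D_x_def D_y_def A_def B_def
        diff_divide_distrib algebra_simps)
  then have "gsum N (\<lambda>i j. div_h h F i j * g i j + edge_dot F (grad_h h g) i j)
      = gsum N (\<lambda>i j. (A i j - A (i - 1) j) + (B i j - B i (j - 1)))" by simp
  also have "\<dots> = 0" by (simp add: gsum_add gsum_diff gsum_shift[OF per(1)] gsum_shift[OF per(2)])
  finally show ?thesis by (simp add: gsum_add)
qed

lemma laplace_by_parts:
  assumes "f \<in> C_per N" "g \<in> C_per N"
  shows "gsum N (\<lambda>i j. laplace_h h f i j * g i j) = - gsum N (edge_dot (grad_h h f) (grad_h h g))"
  unfolding laplace_h_def using assms by (intro sum_by_parts grad_per)

lemma laplace_symmetric:
  assumes "f \<in> C_per N" "g \<in> C_per N"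
  shows "gsum N (\<lambda>i j. f i j * laplace_h h g i j) = gsum N (\<lambda>i j. laplace_h h f i j * g i j)"
  using laplace_by_parts[OF assms, of h] laplace_by_parts[OF assms(2,1), of h]
  by (simp add: mult.commute edge_dot_def)

lemma laplace_nonpos:
  assumes "g \<in> C_per N"
  shows "gsum N (\<lambda>i j. g i j * laplace_h h g i j) \<le> 0"
  using laplace_by_parts[OF assms assms, of h]
    gsum_nonneg[of "edge_dot (grad_h h g) (grad_h h g)" N]
  by (simp add: edge_dot_def mult.commute)

text \<open>Averaging from cells to edges is adjoint to averaging from edges to cells. This turns
  the cellwise derivative of \<open>avg_grad\<close> into the edge flux
  \<open>edge_mult (edge_avg g) F\<close> whose divergence appears in \<open>mu_phi\<close>.\<close>

lemma gsum_cell_avg: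
  assumes g: "g \<in> C_per N" and F: "F \<in> edge_per N" and G: "G \<in> edge_per N"
  shows "gsum N (\<lambda>i j. g i j * cell_avg (edge_mult F G) i j)
    = gsum N (edge_dot (edge_mult (edge_avg g) F) G)"
proof -
  \<comment> \<open>The two sides differ only in the cell to which half of each edge product is
    assigned, so their difference telescopes.\<close>
  define A B where "A = (\<lambda>i j. g (i + 1) j * (fst F i j * fst G i j) / 2)"
    and "B = (\<lambda>i j. g i (j + 1) * (snd F i j * snd G i j) / 2)"
  have per: "A \<in> C_per N" "B \<in> C_per N"
    using g F G by (auto simp: A_def B_def edge_per_def C_per_shifts intro!: C_perI)
  have "g i j * cell_avg (edge_mult F G) i j - edge_dot (edge_mult (edge_avg g) F) G i j
      = (A (i - 1) j - A i j) + (B i (j - 1) - B i j)" for i j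
    by (simp add: cell_avg_def edge_dot_def edge_mult_def edge_avg_def A_def B_def field_simps)
  then have "gsum N (\<lambda>i j. g i j * cell_avg (edge_mult F G) i j
        - edge_dot (edge_mult (edge_avg g) F) G i j)
      = gsum N (\<lambda>i j. (A (i - 1) j - A i j) + (B i (j - 1) - B i j))" by simp
  also have "\<dots> = 0" by (simp add: gsum_add gsum_diff gsum_shift[OF per(1)] gsum_shift[OF per(2)])
  finally show ?thesis by (simp add: gsum_diff)
qed

lemma gsum_cell_avg_1:
  assumes "F \<in> edge_per N" "G \<in> edge_per N"
  shows "gsum N (cell_avg (edge_mult F G)) = gsum N (edge_dot F G)"
  using gsum_cell_avg[of "\<lambda>i j. 1" N F G] assms
  by (simp add: C_per_def edge_mult_def edge_avg_def)

lemma grad_h_diff: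
  "fst (grad_h h (\<lambda>i j. u i j - v i j)) i j = fst (grad_h h u) i j - fst (grad_h h v) i j"
  "snd (grad_h h (\<lambda>i j. u i j - v i j)) i j = snd (grad_h h u) i j - snd (grad_h h v) i j"
  by (simp_all add: grad_h_def D_x_def D_y_def diff_divide_distrib)

lemma laplace_h_diff:
  "laplace_h h (\<lambda>i j. u i j - v i j) i j = laplace_h h u i j - laplace_h h v i j"
  by (simp add: laplace_h_def div_h_def grad_h_diff diff_divide_distrib)

subsection \<open>The energy estimate\<close>

lemma grad_sq_tangent:
  "(grad_sq h u i j - grad_sq h v i j) / 2
    \<le> edge_dot (grad_h h u) (grad_h h (\<lambda>i j. u i j - v i j)) i j"
proof -
  have "grad_sq h w i j = (fst (grad_h h w) i j)\<^sup>2 + (snd (grad_h h w) i j)\<^sup>2" for w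
    by (simp add: grad_sq_def grad_h_def)
  then show ?thesis
    using half_square_tangent[of "fst (grad_h h u) i j" "fst (grad_h h v) i j"]
      half_square_tangent[of "snd (grad_h h u) i j" "snd (grad_h h v) i j"]
    unfolding edge_dot_def grad_h_diff by (simp add: field_simps)
qed

lemma avg_grad_coupling_tangent:
  fixes r s u v h \<delta> i j
  defines "a \<equiv> avg_grad h \<delta> u i j" and "b \<equiv> avg_grad h \<delta> v i j"
    and "d \<equiv> (\<lambda>i j. u i j - v i j)"
  assumes "\<delta> > 0" "0 \<le> r" "r \<le> 1"
  shows "((r - a)\<^sup>2 - (s - b)\<^sup>2) / 2 \<le>
    (1 + 1 / \<delta>) * cell_avg (edge_mult (grad_h h u) (grad_h h d)) i j
    - 1 / \<delta> * cell_avg (edge_mult (grad_h h v) (grad_h h d)) i j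
    - r / a * cell_avg (edge_mult (grad_h h u) (grad_h h d)) i j
    - a * (r - s) + sqrt 2 * r * (r - s) - (sqrt 2 - 1) * s * (r - s)"
proof -
  \<comment> \<open>The four edge differences around the cell form a vector in R^4. The factor 1 /
    sqrt 2 makes its inner product equal to \<open>cell_avg\<close>, so
    \<open>coupling_tangent\<close> applies in this space.\<close>
  define P where "P w = (fst (grad_h h w) i j / sqrt 2, fst (grad_h h w) (i - 1) j / sqrt 2,
    snd (grad_h h w) i j / sqrt 2, snd (grad_h h w) i (j - 1) / sqrt 2)" for w
  have inner: "P w \<bullet> P z = cell_avg (edge_mult (grad_h h w) (grad_h h z)) i j" for w z
    by (simp add: P_def cell_avg_def edge_mult_def add_divide_distrib)
  have "P u - P v = P d"
    by (simp add: P_def d_def grad_h_diff diff_divide_distrib)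
  moreover have "avg_grad h \<delta> w i j = sqrt (P w \<bullet> P w + \<delta>\<^sup>2)" for w
    unfolding inner by (simp add: avg_grad_def cell_avg_def edge_mult_def grad_h_def power2_eq_square)
  ultimately show ?thesis
    using coupling_tangent[of \<delta> r a "P u" b "P v" s] assms by (simp add: inner)
qed

text \<open>Inequalities enter only through the cellwise tangent bounds; the passage to the chemical
  potentials is an exact identity of sums. The scheme itself is not yet used: \<open>u\<close>,
  \<open>r\<close> and \<open>v\<close>, \<open>s\<close> are arbitrary admissible states.\<close>

lemma energy_increment:
  fixes \<alpha> \<beta> \<epsilon> \<eta> \<xi> \<delta> h :: real and u v r s :: grid_fun
  defines "d \<equiv> (\<lambda>i j. u i j - v i j)" and "w \<equiv> (\<lambda>i j. r i j - s i j)"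
  assumes pos: "\<alpha> > 0" "\<beta> > 0" "\<epsilon> > 0" "\<xi> > 0" "\<delta> > 0"
    and per: "u \<in> C_per N" "v \<in> C_per N" "r \<in> C_per N" "s \<in> C_per N"
    and r: "\<And>i j. 0 < r i j \<and> r i j < 1" and s: "\<And>i j. 0 < s i j \<and> s i j < 1"
  shows "energy \<alpha> \<beta> \<epsilon> \<eta> \<xi> \<delta> N h u r - energy \<alpha> \<beta> \<epsilon> \<eta> \<xi> \<delta> N h v s
    \<le> h\<^sup>2 * (gsum N (\<lambda>i j. mu_phi \<alpha> \<epsilon> \<eta> \<delta> h v u r i j * d i j)
          + gsum N (\<lambda>i j. mu_rho \<alpha> \<beta> \<xi> \<delta> h s u r i j * w i j))"
proof -
  define g where "g = (\<lambda>k l. r k l / avg_grad h \<delta> u k l)"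
  have dper: "d \<in> C_per N" and wper: "w \<in> C_per N" and gper: "g \<in> C_per N"
    using per C_perD[OF avg_grad_per[OF per(1)]]
    by (auto simp: d_def w_def g_def C_perD intro!: C_perI)
  define e where "e \<phi> \<rho> = (\<lambda>i j. f_dw (\<phi> i j) / \<epsilon> + \<epsilon> / 2 * grad_sq h \<phi> i j
    + \<eta>\<^sup>2 / 2 * \<bar>laplace_h h \<phi> i j\<bar>\<^sup>2 + \<xi> / 2 * grad_sq h \<rho> i j
    + \<alpha> / 2 * (\<rho> i j - avg_grad h \<delta> \<phi> i j)\<^sup>2 + \<beta> * H_mix (\<rho> i j))" for \<phi> \<rho>
  have energy: "energy \<alpha> \<beta> \<epsilon> \<eta> \<xi> \<delta> N h \<phi> \<rho> = h\<^sup>2 * gsum N (e \<phi> \<rho>)" for \<phi> \<rho>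
    by (simp add: energy_def gsum_def e_def)
  let ?cu = "cell_avg (edge_mult (grad_h h u) (grad_h h d))"
  let ?cv = "cell_avg (edge_mult (grad_h h v) (grad_h h d))"
  \<comment> \<open>\<open>T\<close> collects the tangent terms of all energy contributions, with
    derivatives still on the increments \<open>d\<close> and \<open>w\<close>.\<close>
  define T where "T = (\<lambda>i j.
      1 / \<epsilon> * ((u i j - 1 / 2) ^ 3 * d i j) - 1 / (4 * \<epsilon>) * ((v i j - 1 / 2) * d i j)
    + \<epsilon> * edge_dot (grad_h h u) (grad_h h d) i j
    + \<eta>\<^sup>2 * (laplace_h h u i j * laplace_h h d i j)
    + \<xi> * edge_dot (grad_h h r) (grad_h h w) i j
    + (\<alpha> + \<alpha> / \<delta>) * ?cu i j - \<alpha> / \<delta> * ?cv i j - \<alpha> * (g i j * ?cu i j)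
    - \<alpha> * (avg_grad h \<delta> u i j * w i j) + sqrt 2 * \<alpha> * (r i j * w i j)
    - \<alpha> * (sqrt 2 - 1) * (s i j * w i j)
    + \<beta> * ((ln (r i j) - ln (1 - r i j)) * w i j))"
  have "e u r i j - e v s i j \<le> T i j" for i j
  proof -
    have "1 / \<epsilon> * (f_dw (u i j) - f_dw (v i j))
        \<le> 1 / \<epsilon> * (((u i j - 1 / 2) ^ 3 - (v i j - 1 / 2) / 4) * d i j)"
      unfolding d_def using pos by (intro mult_left_mono f_dw_tangent) simp
    moreover have "\<epsilon> * ((grad_sq h u i j - grad_sq h v i j) / 2)
        \<le> \<epsilon> * edge_dot (grad_h h u) (grad_h h d) i j"
      unfolding d_def using pos by (intro mult_left_mono grad_sq_tangent) simp
    moreover have "\<eta>\<^sup>2 * (((laplace_h h u i j)\<^sup>2 - (laplace_h h v i j)\<^sup>2) / 2)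
        \<le> \<eta>\<^sup>2 * (laplace_h h u i j * laplace_h h d i j)"
      unfolding d_def laplace_h_diff by (intro mult_left_mono half_square_tangent) simp
    moreover have "\<xi> * ((grad_sq h r i j - grad_sq h s i j) / 2)
        \<le> \<xi> * edge_dot (grad_h h r) (grad_h h w) i j"
      unfolding w_def using pos by (intro mult_left_mono grad_sq_tangent) simp
    moreover have "\<beta> * (H_mix (r i j) - H_mix (s i j))
        \<le> \<beta> * ((ln (r i j) - ln (1 - r i j)) * w i j)"
      unfolding w_def using pos r s by (intro mult_left_mono H_mix_tangent) auto
    moreover have "\<alpha> * (((r i j - avg_grad h \<delta> u i j)\<^sup>2 - (s i j - avg_grad h \<delta> v i j)\<^sup>2) / 2)
        \<le> \<alpha> * ((1 + 1 / \<delta>) * ?cu i j - 1 / \<delta> * ?cv i j - g i j * ?cu i j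
          - avg_grad h \<delta> u i j * w i j + sqrt 2 * r i j * w i j - (sqrt 2 - 1) * s i j * w i j)"
      unfolding w_def d_def g_def using pos r[of i j]
      by (intro mult_left_mono avg_grad_coupling_tangent) simp_all
    ultimately show ?thesis
      by (simp add: e_def T_def algebra_simps diff_divide_distrib add_divide_distrib)
  qed
  then have "gsum N (e u r) - gsum N (e v s) \<le> gsum N T"
    unfolding gsum_diff[symmetric] by (rule gsum_mono)
  also have "gsum N T = gsum N (\<lambda>i j. mu_phi \<alpha> \<epsilon> \<eta> \<delta> h v u r i j * d i j)
      + gsum N (\<lambda>i j. mu_rho \<alpha> \<beta> \<xi> \<delta> h s u r i j * w i j)"
  proof -
    \<comment> \<open>Moving derivatives off \<open>d\<close> and \<open>w\<close>:
      \<open>eu\<close> and \<open>cu\<close> together give the coefficient -(\<epsilon> + \<alpha>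
      + \<alpha> / \<delta>) of the implicit Laplacian, \<open>cv\<close> the explicit Laplacian,
      and \<open>gcu\<close> the nonlinear flux.\<close>
    have cu: "gsum N ?cu = - gsum N (\<lambda>i j. laplace_h h u i j * d i j)"
      and cv: "gsum N ?cv = - gsum N (\<lambda>i j. laplace_h h v i j * d i j)"
      using per dper by (simp_all add: gsum_cell_avg_1 grad_per laplace_by_parts)
    have gcu: "gsum N (\<lambda>i j. g i j * ?cu i j)
        = - gsum N (\<lambda>i j. div_h h (edge_mult (edge_avg g) (grad_h h u)) i j * d i j)"
      using per dper gper by (simp add: gsum_cell_avg sum_by_parts grad_per edge_mult_per edge_avg_per)
    have ll: "gsum N (\<lambda>i j. laplace_h h u i j * laplace_h h d i j)
        = gsum N (\<lambda>i j. laplace_h h (laplace_h h u) i j * d i j)"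
      using per dper by (simp add: laplace_symmetric laplace_per)
    have eu: "gsum N (edge_dot (grad_h h u) (grad_h h d)) = - gsum N (\<lambda>i j. laplace_h h u i j * d i j)"
      and er: "gsum N (edge_dot (grad_h h r) (grad_h h w)) = - gsum N (\<lambda>i j. laplace_h h r i j * w i j)"
      using per dper wper by (simp_all add: laplace_by_parts)
    have phi: "(\<lambda>i j. mu_phi \<alpha> \<epsilon> \<eta> \<delta> h v u r i j * d i j) = (\<lambda>i j.
        1 / \<epsilon> * ((u i j - 1 / 2) ^ 3 * d i j)
      - (\<epsilon> + \<alpha> + \<alpha> / \<delta>) * (laplace_h h u i j * d i j)
      + \<eta>\<^sup>2 * (laplace_h h (laplace_h h u) i j * d i j)
      + \<alpha> * (div_h h (edge_mult (edge_avg g) (grad_h h u)) i j * d i j)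
      - 1 / (4 * \<epsilon>) * ((v i j - 1 / 2) * d i j)
      + \<alpha> / \<delta> * (laplace_h h v i j * d i j))"
      unfolding mu_phi_def g_def[symmetric] by (simp only: left_diff_distrib distrib_right mult.assoc)
    have rho: "(\<lambda>i j. mu_rho \<alpha> \<beta> \<xi> \<delta> h s u r i j * w i j) = (\<lambda>i j.
      - \<xi> * (laplace_h h r i j * w i j) + \<beta> * ((ln (r i j) - ln (1 - r i j)) * w i j)
      + sqrt 2 * \<alpha> * (r i j * w i j) - \<alpha> * (avg_grad h \<delta> u i j * w i j)
      - \<alpha> * (sqrt 2 - 1) * (s i j * w i j))"
      unfolding mu_rho_def by (simp only: left_diff_distrib distrib_right mult.assoc)
    show ?thesis
      unfolding phi rho T_def gsum_add gsum_diff gsum_cmult cu cv gcu ll eu er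
      by (simp add: algebra_simps)
  qed
  finally show ?thesis
    unfolding energy right_diff_distrib[symmetric] by (rule mult_left_mono) simp
qed

section \<open>Dissipation along one step of the scheme\<close>

theorem theorem3p2:
  fixes \<alpha> \<beta> \<epsilon> \<eta> \<xi> \<delta> M L h dt :: real
    and N n :: nat
    and \<phi> \<rho> :: "nat \<Rightarrow> grid_fun"
  assumes "\<alpha> > 0" "\<beta> > 0" "\<epsilon> > 0" "\<eta> > 0" "\<xi> > 0" "\<delta> > 0" "M > 0"
    and "L > 0" and "N > 0" and "h = L / real N"
    and "dt > 0"
    and "n \<ge> 1"
    and "\<phi> n \<in> C_per N" "\<rho> n \<in> C_per N" "\<phi> (Suc n) \<in> C_per N" "\<rho> (Suc n) \<in> C_per N"
    and "\<And>i j. 0 < \<rho> n i j \<and> \<rho> n i j < 1"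
    and "\<And>i j. 0 < \<rho> (Suc n) i j \<and> \<rho> (Suc n) i j < 1"
    and "scheme_step \<alpha> \<beta> \<epsilon> \<eta> \<xi> \<delta> M h dt (\<phi> n) (\<rho> n) (\<phi> (Suc n)) (\<rho> (Suc n))"
  shows "energy \<alpha> \<beta> \<epsilon> \<eta> \<xi> \<delta> N h (\<phi> (Suc n)) (\<rho> (Suc n))
           \<le> energy \<alpha> \<beta> \<epsilon> \<eta> \<xi> \<delta> N h (\<phi> n) (\<rho> n)"
proof -
  let ?u = "\<phi> (Suc n)" and ?v = "\<phi> n" and ?r = "\<rho> (Suc n)" and ?s = "\<rho> n"
  let ?m = "mu_phi \<alpha> \<epsilon> \<eta> \<delta> h ?v ?u ?r" and ?k = "mu_rho \<alpha> \<beta> \<xi> \<delta> h ?s ?u ?r"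
  note per = assms(13-16)
  have step: "?u i j - ?v i j = dt * M * laplace_h h ?m i j"
    "?r i j - ?s i j = dt * M * laplace_h h ?k i j" for i j
    using assms(19) \<open>dt > 0\<close> unfolding scheme_step_def by (simp_all add: field_simps)
  have dissipation: "gsum N (\<lambda>i j. g i j * (dt * M * laplace_h h g i j)) \<le> 0"
    if "g \<in> C_per N" for g
    unfolding mult.left_commute[of _ "dt * M"] gsum_cmult
    using laplace_nonpos[OF that, of h] \<open>dt > 0\<close> \<open>M > 0\<close> by (simp add: mult_le_0_iff)
  have "energy \<alpha> \<beta> \<epsilon> \<eta> \<xi> \<delta> N h ?u ?r - energy \<alpha> \<beta> \<epsilon> \<eta> \<xi> \<delta> N h ?v ?s
    \<le> h\<^sup>2 * (gsum N (\<lambda>i j. ?m i j * (?u i j - ?v i j)) + gsum N (\<lambda>i j. ?k i j * (?r i j - ?s i j)))"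
    using assms by (intro energy_increment) auto
  \<comment> \<open>By \<open>step\<close> each increment is \<open>dt * M\<close> times the
    Laplacian of its own potential, so both pairings are nonpositive.\<close>
  also have "\<dots> \<le> 0"
    unfolding step using dissipation[OF mu_phi_per[OF per(1,3,4)], of \<alpha> \<epsilon> \<eta> \<delta> h]
      dissipation[OF mu_rho_per[OF per(2,3,4)], of \<alpha> \<beta> \<xi> \<delta> h]
    by (intro mult_nonneg_nonpos add_nonpos_nonpos) simp_all
  finally show ?thesis by simp
qed

end
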